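(* For every natural number $l \ge 4$, $h(4,l) \le \binom{l-1}{2}+1$, where $h$ is the convexification function defined in the context.
   Context: All point sets are finite, in the plane, non-vertical (no vertical line contains two of the points) and in general position (no three points collinear), including unions of two sets under consideration. Points $(x_1,y_1),\dots,(x_k,y_k)$ form a $k$-cup if $x_1<\dots<x_k$ and the slopes $\frac{y_{i+1}-y_i}{x_{i+1}-x_i}$ are strictly increasing; they form a $k$-cap if $x_1<\dots<x_k$ and these slopes are strictly decreasing. For $m,l\ge 3$ a set is $(m,l)$-free if it contains no $m$-cup and no $l$-cap. A convex $n$-gon means $n$ points of the set in convex position. For $m,l \ge 3$, a point $s$ of a set $S$ is an $(m,l)$-convexifying point for $S$ if $s$ is the leftmost point of an $(l-1)$-cap in $S$ and, for every natural number $n\ge 4$ and every set $B$ with $B\cap S=\emptyset$ such that $B\cup S$ contains an $(n-1)$-cup whose left endpoint is $s$ and whose right endpoint is in $B$, the set $B\cup S$ contains at least one of: an $m$-cup whose two leftmost points belong to $S$; an $l$-cap whose two rightmost points belong to $S$; a convex $n$-gon. The convexification function $h(m,l)$ is the maximum number such that there exists an $(m,l)$-free set of $h(m,l)$ points with no $(m,l)$-convexifying point. *)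

theory Defs
  imports "HOL-Analysis.Analysis"
begin

type_synonym point = "real \<times> real"

definition admissible :: "point set \<Rightarrow> bool" where
  "admissible P \<longleftrightarrow> finite P \<and> inj_on fst P \<and>
     (\<forall>a\<in>P. \<forall>b\<in>P. \<forall>c\<in>P. a \<noteq> b \<and> a \<noteq> c \<and> b \<noteq> c \<longrightarrow> \<not> collinear {a, b, c})"

definition slope :: "point \<Rightarrow> point \<Rightarrow> real" where
  "slope p q = (snd q - snd p) / (fst q - fst p)"

text \<open>Cups and caps are lists of points in left-to-right order, so that their left and right
  endpoints are \<open>hd ps\<close> and \<open>last ps\<close>; \<open>map2 slope ps (tl ps)\<close> is the list of the slopes of
  consecutive points.\<close>

definition is_cup :: "nat \<Rightarrow> point list \<Rightarrow> bool" where
  "is_cup k ps \<longleftrightarrow> length ps = k \<and> sorted_wrt (<) (map fst ps) \<and>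
     sorted_wrt (<) (map2 slope ps (tl ps))"

definition is_cap :: "nat \<Rightarrow> point list \<Rightarrow> bool" where
  "is_cap k ps \<longleftrightarrow> length ps = k \<and> sorted_wrt (<) (map fst ps) \<and>
     sorted_wrt (>) (map2 slope ps (tl ps))"

definition cup_cap_free :: "nat \<Rightarrow> nat \<Rightarrow> point set \<Rightarrow> bool" where
  "cup_cap_free m l S \<longleftrightarrow>
     (\<nexists>ps. set ps \<subseteq> S \<and> is_cup m ps) \<and> (\<nexists>ps. set ps \<subseteq> S \<and> is_cap l ps)"

definition convex_position :: "point set \<Rightarrow> bool" where
  "convex_position T \<longleftrightarrow> (\<forall>p\<in>T. p \<notin> convex hull (T - {p}))"

definition has_convex_gon :: "nat \<Rightarrow> point set \<Rightarrow> bool" where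
  "has_convex_gon n P \<longleftrightarrow> (\<exists>T\<subseteq>P. finite T \<and> card T = n \<and> convex_position T)"

text \<open>Admissibility is required of \<open>B \<union> S\<close>, and hence holds for \<open>B\<close> and \<open>S\<close>
  separately.\<close>

definition convexifying_point :: "nat \<Rightarrow> nat \<Rightarrow> point set \<Rightarrow> point \<Rightarrow> bool" where
  "convexifying_point m l S s \<longleftrightarrow> s \<in> S \<and>
     (\<exists>ps. set ps \<subseteq> S \<and> is_cap (l - 1) ps \<and> hd ps = s) \<and>
     (\<forall>n\<ge>4. \<forall>B. B \<inter> S = {} \<and> admissible (B \<union> S) \<and>
        (\<exists>ps. set ps \<subseteq> B \<union> S \<and> is_cup (n - 1) ps \<and> hd ps = s \<and> last ps \<in> B) \<longrightarrow>
        (\<exists>ps. set ps \<subseteq> B \<union> S \<and> is_cup m ps \<and> set (take 2 ps) \<subseteq> S) \<or>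
        (\<exists>ps. set ps \<subseteq> B \<union> S \<and> is_cap l ps \<and> set (drop (l - 2) ps) \<subseteq> S) \<or>
        has_convex_gon n (B \<union> S))"

definition convexification :: "nat \<Rightarrow> nat \<Rightarrow> nat" where
  "convexification m l = (GREATEST k. \<exists>S. admissible S \<and> card S = k \<and>
     cup_cap_free m l S \<and> (\<nexists>s. convexifying_point m l S s))"

end

theory Submission imports Defs begin

text \<open>Let \<open>S\<close> be free with \<open>card S > (l-1 choose 2) + 1\<close>. By the Erdos--Szekeres cup-cap theorem,
  \<open>S\<close> minus its leftmost point \<open>a\<close> still contains an \<open>(l-1)\<close>-cap \<open>s, c, \<dots>\<close>; then \<open>s\<close> is
  convexifying. Freeness forces \<open>slope a s < slope s c\<close>. Let \<open>s, \<dots>, q, r, b\<close> be an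
  \<open>(n-1)\<close>-cup with \<open>b \<in> B\<close>.
  If \<open>c\<close> lies above the line \<open>s b\<close>, then either \<open>c\<close> completes the cup to a convex
  \<open>n\<close>-gon, or \<open>r, b, c, \<dots>\<close> is an \<open>l\<close>-cap.
  If \<open>c\<close> lies below that line and to the left of \<open>b\<close>, then \<open>a, s, c, b\<close> is a \<open>4\<close>-cup.
  Otherwise \<open>a, s, r, b\<close> is a \<open>4\<close>-cup unless \<open>r\<close> is below the line \<open>a s\<close>; in that case either
  \<open>q, r, c, \<dots>\<close> is an \<open>l\<close>-cap, or \<open>s, \<dots>, q, r, c\<close> is a cup which \<open>b\<close> completes to a
  convex \<open>n\<close>-gon.\<close>

section \<open>Slopes\<close>

definition intercept :: "real \<Rightarrow> point \<Rightarrow> real" where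
  "intercept t p = snd p - t * fst p"

lemma intercept_eq_inner: "intercept t p = inner (- t, 1) p"
  by (simp add: intercept_def inner_prod_def)

lemma slope_commute: "slope p q = slope q p"
  unfolding slope_def by (metis minus_diff_eq minus_divide_divide)

lemma slope_less_iff_intercept:
  "fst p < fst q \<Longrightarrow> slope p q < t \<longleftrightarrow> intercept t q < intercept t p"
  by (auto simp: slope_def intercept_def field_simps)

lemma less_slope_iff_intercept:
  "fst p < fst q \<Longrightarrow> t < slope p q \<longleftrightarrow> intercept t p < intercept t q"
  by (auto simp: slope_def intercept_def field_simps)

lemma intercept_slope:
  "fst p \<noteq> fst q \<Longrightarrow> intercept (slope p q) p = intercept (slope p q) q"
  by (simp add: slope_def intercept_def field_simps)

lemma chord_slope_iff_left:
  assumes "fst p < fst q" "fst q < fst r"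
  shows "slope p q < slope p r \<longleftrightarrow> slope p q < slope q r"
    and "slope p r < slope p q \<longleftrightarrow> slope q r < slope p q"
  using assms intercept_slope[of p q]
    slope_less_iff_intercept[of _ r "slope p q"] less_slope_iff_intercept[of _ r "slope p q"]
  by simp_all

lemma chord_slope_iff_right:
  assumes "fst p < fst q" "fst q < fst r"
  shows "slope p r < slope q r \<longleftrightarrow> slope p q < slope q r"
    and "slope q r < slope p r \<longleftrightarrow> slope q r < slope p q"
  using assms intercept_slope[of q r]
    slope_less_iff_intercept[of p _ "slope q r"] less_slope_iff_intercept[of p _ "slope q r"]
  by simp_all

lemma min_intercept_less_if_above_chord:
  assumes "fst s < fst x" "fst x < fst b" "slope s b < slope s x"
  shows "min (intercept t s) (intercept t b) < intercept t x"
proof (cases "t \<le> slope s b")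
  case True
  then have "intercept t s < intercept t x"
    using assms less_slope_iff_intercept[of s x t] by simp
  then show ?thesis by simp
next
  case False
  have "slope x b < slope s b"
    using assms chord_slope_iff_left(2) chord_slope_iff_right(2) by blast
  then have "intercept t b < intercept t x"
    using assms False slope_less_iff_intercept[of x b t] by simp
  then show ?thesis by simp
qed

lemma collinear_if_slope_eq:
  assumes "fst p \<noteq> fst q" "fst r \<noteq> fst q" "slope p q = slope q r"
  shows "collinear {p, q, r}"
proof -
  have "snd p - snd q = slope p q * (fst p - fst q)" "snd r - snd q = slope q r * (fst r - fst q)"
    using assms(1,2) by (simp_all add: slope_def field_simps)
  then have "r - q = ((fst r - fst q) / (fst p - fst q)) *\<^sub>R (p - q)"
    using assms(1,3) by (simp add: prod_eq_iff)
  then show ?thesis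
    by (subst collinear_3) (auto simp: collinear_lemma)
qed

section \<open>Admissible sets\<close>

lemma admissible_subset: "admissible P \<Longrightarrow> Q \<subseteq> P \<Longrightarrow> admissible Q"
  unfolding admissible_def by (meson finite_subset inj_on_subset subsetD)

lemma admissible_fst_eq_iff:
  "admissible P \<Longrightarrow> p \<in> P \<Longrightarrow> q \<in> P \<Longrightarrow> fst p = fst q \<longleftrightarrow> p = q"
  unfolding admissible_def by (metis inj_on_eq_iff)

lemma admissible_slope_neq:
  assumes "admissible P" "p \<in> P" "q \<in> P" "r \<in> P" "p \<noteq> q" "p \<noteq> r" "q \<noteq> r"
  shows "slope p q \<noteq> slope q r"
proof
  assume "slope p q = slope q r"
  then have "collinear {p, q, r}"
    using assms by (intro collinear_if_slope_eq) (auto simp: admissible_fst_eq_iff)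
  then show False using assms unfolding admissible_def by blast
qed

section \<open>Cups and caps\<close>

lemma map2_tl_append:
  "map2 f (xs @ q # ys) (tl (xs @ q # ys)) =
    map2 f (xs @ [q]) (tl (xs @ [q])) @ map2 f (q # ys) ys"
proof (induction xs)
  case (Cons x xs)
  then show ?case by (cases xs) auto
qed simp

lemma is_cup_tl: "is_cup k (p # ps) \<Longrightarrow> is_cup (k - 1) ps"
  unfolding is_cup_def by (cases ps) auto

lemma is_cup_butlast: "is_cup k (xs @ [p, q]) \<Longrightarrow> is_cup (k - 1) (xs @ [p])"
  using map2_tl_append[of slope xs p "[q]"] unfolding is_cup_def
  by (auto simp: sorted_wrt_append)

lemma is_cup_snoc:
  assumes "is_cup k (xs @ [p, q])" "fst q < fst r" "slope p q < slope q r"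
  shows "is_cup (Suc k) (xs @ [p, q, r])"
  using assms map2_tl_append[of slope xs p "[q]"] map2_tl_append[of slope xs p "[q, r]"]
  unfolding is_cup_def by (auto simp: sorted_wrt_append intro: less_trans)

lemma is_cap_Cons_iff:
  "is_cap k (p # q # r # xs) \<longleftrightarrow>
    is_cap (k - 1) (q # r # xs) \<and> fst p < fst q \<and> slope q r < slope p q"
  unfolding is_cap_def by auto

lemma is_cup_snocE:
  assumes "is_cup k ps" "2 \<le> k"
  obtains xs p q where "ps = xs @ [p, q]" "fst p < fst q"
proof -
  have "2 \<le> length (rev ps)" using assms by (simp add: is_cup_def)
  then obtain q p ys where "rev ps = q # p # ys" by (metis Suc_le_length_iff numeral_2_eq_2)
  then have "ps = rev ys @ [p, q]" by (simp add: rev_eq_Cons_iff)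
  then show ?thesis using that assms(1) by (auto simp: is_cup_def sorted_wrt_append)
qed

lemma cup_fst_hd_less_last:
  assumes "is_cup k ps" "2 \<le> k"
  shows "fst (hd ps) < fst (last ps)"
proof -
  obtain xs p q where "ps = xs @ [p, q]"
    using is_cup_snocE[OF assms] .
  then show ?thesis
    using assms(1) unfolding is_cup_def by (cases xs) (auto simp: sorted_wrt_append)
qed

lemma cup_or_cap_extends:
  assumes adm: "admissible P" and cup: "is_cup k ps" "2 \<le> k" "set ps \<subseteq> P"
    and cap: "is_cap l (last ps # r # rs)" "r \<in> P"
  shows "is_cup (Suc k) (ps @ [r]) \<or> (\<exists>p \<in> P. is_cap (Suc l) (p # last ps # r # rs))"
proof -
  obtain xs p q where ps: "ps = xs @ [p, q]" "fst p < fst q"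
    using is_cup_snocE[OF cup(1,2)] .
  have "fst q < fst r" using cap(1) by (simp add: ps(1) is_cap_def)
  then have "slope p q \<noteq> slope q r"
    using adm cup(3) cap(2) ps by (intro admissible_slope_neq[of P]) auto
  then consider (left_turn) "slope p q < slope q r" | (right_turn) "slope q r < slope p q"
    by linarith
  then show ?thesis
  proof cases
    case left_turn
    then show ?thesis
      using is_cup_snoc cup(1) \<open>fst q < fst r\<close> by (simp add: ps(1))
  next
    case right_turn
    then have "is_cap (Suc l) (p # last ps # r # rs)"
      using cap(1) ps by (simp add: is_cap_Cons_iff)
    then show ?thesis using cup(3) ps(1) by auto
  qed
qed

lemma is_cap_replace_hd:
  assumes cap: "is_cap k (s # c # cs)"
    and y: "fst s < fst y" "fst y < fst c" "slope s y < slope s c"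
  shows "is_cap k (y # c # cs)"
proof -
  have "slope s c < slope y c"
    using y chord_slope_iff_left(1) chord_slope_iff_right(1) by blast
  then show ?thesis
    using cap y by (cases cs) (auto simp: is_cap_def)
qed

lemma cup_or_cap_extends_below_chord:
  assumes adm: "admissible P" and cup: "is_cup k ps" "2 \<le> k" "set ps \<subseteq> P"
    and cap: "is_cap l (hd ps # r # rs)" "r \<in> P"
    and last: "fst (last ps) < fst r" "slope (hd ps) (last ps) < slope (hd ps) r"
  shows "is_cup (Suc k) (ps @ [r]) \<or> (\<exists>p \<in> P. is_cap (Suc l) (p # last ps # r # rs))"
proof -
  have "is_cap l (last ps # r # rs)"
    using is_cap_replace_hd[OF cap(1)] cup_fst_hd_less_last[OF cup(1,2)] last by blast
  then show ?thesis using cup_or_cap_extends[OF adm cup] cap(2) by blast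
qed

lemma cup_slope_less_second:
  "is_cup k (p # q # qs) \<Longrightarrow> z \<in> set qs \<Longrightarrow> slope p q < slope q z"
proof (induction qs arbitrary: k p q)
  case (Cons r rs)
  have less: "fst q < fst r" "slope p q < slope q r"
    and cup: "is_cup (k - 1) (q # r # rs)"
    using Cons.prems(1) is_cup_tl[OF Cons.prems(1)] by (simp_all add: is_cup_def)
  show ?case
  proof (cases "z = r")
    case False
    then have "z \<in> set rs" using Cons.prems(2) by simp
    then have "slope q r < slope r z" and "fst r < fst z"
      using Cons.IH[OF cup] cup by (auto simp: is_cup_def)
    then show ?thesis
      using less chord_slope_iff_left(1)[of q r z] by simp
  qed (simp add: less)
qed simp

lemma cup_slope_less:
  "is_cup k (xs @ p # ys) \<Longrightarrow> a \<in> set xs \<Longrightarrow> b \<in> set ys \<Longrightarrow> slope a p < slope p b"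
proof (induction xs arbitrary: k a)
  case (Cons x xs)
  have cup_tl: "is_cup (k - 1) (xs @ p # ys)" using Cons.prems(1) is_cup_tl by simp
  consider (later) "a \<in> set xs" | (only) "a = x" "xs = []"
    | (first) q qs where "a = x" "xs = q # qs"
    using Cons.prems(2) by (cases xs) auto
  then show ?case
  proof cases
    case later
    then show ?thesis using Cons.IH[OF cup_tl] Cons.prems(3) by simp
  next
    case only
    then show ?thesis using Cons.prems cup_slope_less_second[of k x p ys b] by simp
  next
    case first
    have "slope x q < slope q p"
      using Cons.prems(1) first(2) by (intro cup_slope_less_second[of k x q "qs @ p # ys"]) auto
    moreover have "fst x < fst q" "fst q < fst p"
      using Cons.prems(1) first(2) by (auto simp: is_cup_def)
    ultimately have "slope x p < slope q p" using chord_slope_iff_right(1) by blast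
    also have "\<dots> < slope p b"
      using Cons.IH[OF cup_tl, of q] Cons.prems(3) first(2) by simp
    finally show ?thesis using first(1) by simp
  qed
qed simp

lemma cup_slope_hd_less_last:
  assumes cup: "is_cup k ps" and q: "q \<in> set ps" "q \<noteq> hd ps" "q \<noteq> last ps"
  shows "fst (hd ps) < fst q" "fst q < fst (last ps)" "slope (hd ps) q < slope q (last ps)"
proof -
  obtain xs ys where ps: "ps = xs @ q # ys" using q(1) by (auto simp: in_set_conv_decomp)
  then have ends: "hd ps \<in> set xs" "last ps \<in> set ys"
    using q by (cases xs; auto)+
  then show "fst (hd ps) < fst q" "fst q < fst (last ps)"
    using cup ps by (auto simp: is_cup_def sorted_wrt_append)
  show "slope (hd ps) q < slope q (last ps)"
    using cup_slope_less[of k xs q ys] cup ps ends by simp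
qed

lemma finite_sets_separated:
  fixes A B :: "'a :: unbounded_dense_linorder set"
  assumes "finite A" "finite B" "\<And>a b. a \<in> A \<Longrightarrow> b \<in> B \<Longrightarrow> a < b"
  shows "\<exists>t. (\<forall>a\<in>A. a < t) \<and> (\<forall>b\<in>B. t < b)"
proof -
  consider (no_lower) "A = {}" | (no_upper) "B = {}" | (both) "A \<noteq> {}" "B \<noteq> {}" by blast
  then show ?thesis
  proof cases
    case no_lower
    obtain t where "B = {} \<or> t < Min B" using lt_ex by blast
    then show ?thesis using assms(2) no_lower by (metis Min_gr_iff empty_iff)
  next
    case no_upper
    obtain t where "A = {} \<or> Max A < t" using gt_ex by blast
    then show ?thesis using assms(1) no_upper by (metis Max_less_iff empty_iff)
  next
    case both
    then have "Max A < Min B" using assms by simp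
    then obtain t where "Max A < t" "t < Min B" using dense by blast
    then show ?thesis using assms both by auto
  qed
qed

lemma cup_supporting_line:
  assumes cup: "is_cup k ps" and p: "p \<in> set ps"
  obtains t where "\<And>q. q \<in> set ps - {p} \<Longrightarrow> intercept t p < intercept t q"
proof -
  obtain xs ys where ps: "ps = xs @ p # ys" using p by (auto simp: in_set_conv_decomp)
  have "\<exists>t. (\<forall>u \<in> (\<lambda>q. slope q p) ` set xs. u < t) \<and> (\<forall>v \<in> slope p ` set ys. t < v)"
    using cup_slope_less cup unfolding ps by (intro finite_sets_separated) blast+
  then obtain t
    where t: "\<And>q. q \<in> set xs \<Longrightarrow> slope q p < t" "\<And>q. q \<in> set ys \<Longrightarrow> t < slope p q"
    by blast
  have "intercept t p < intercept t q" if q: "q \<in> set ps - {p}" for q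
  proof -
    consider "q \<in> set xs" "fst q < fst p" | "q \<in> set ys" "fst p < fst q"
      using q cup unfolding ps is_cup_def by (auto simp: sorted_wrt_append)
    then show ?thesis
      using t by cases (simp_all flip: slope_less_iff_intercept less_slope_iff_intercept)
  qed
  then show ?thesis using that by blast
qed

section \<open>Convex position\<close>

lemma not_in_convex_hull_if_inner_less:
  fixes p :: "'a :: real_inner"
  assumes "\<And>q. q \<in> T \<Longrightarrow> inner a p < inner a q"
  shows "p \<notin> convex hull T"
proof -
  have "convex hull T \<subseteq> {z. inner a p < inner a z}"
    using assms by (intro hull_minimal convex_halfspace_gt) auto
  then show ?thesis by auto
qed

lemma convex_position_if_exposed:
  assumes "\<And>p. p \<in> T \<Longrightarrow> \<exists>a. \<forall>q \<in> T - {p}. inner a p < inner a q"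
  shows "convex_position T"
  unfolding convex_position_def using assms not_in_convex_hull_if_inner_less by metis

lemma cup_convex_position: "is_cup k ps \<Longrightarrow> convex_position (set ps)"
  by (intro convex_position_if_exposed) (metis cup_supporting_line intercept_eq_inner)

lemma card_set_cup: "is_cup k ps \<Longrightarrow> card (set ps) = k"
  unfolding is_cup_def by (metis distinct_card distinct_map strict_sorted_iff)

lemma cup_has_convex_gon: "is_cup k ps \<Longrightarrow> set ps \<subseteq> P \<Longrightarrow> has_convex_gon k P"
  unfolding has_convex_gon_def using cup_convex_position card_set_cup by blast

lemma cup_below_chord:
  assumes cup: "is_cup k ps" and q: "q \<in> set ps"
    and neq: "fst (hd ps) \<noteq> fst (last ps)"
  shows "intercept (slope (hd ps) (last ps)) q \<le> intercept (slope (hd ps) (last ps)) (hd ps)"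
proof (cases "q = hd ps \<or> q = last ps")
  case True
  then show ?thesis using intercept_slope[OF neq] by auto
next
  case False
  note inner = cup_slope_hd_less_last[OF cup q]
  have "slope (hd ps) q < slope (hd ps) (last ps)"
    using inner False by (simp add: chord_slope_iff_left(1))
  then show ?thesis
    using inner False by (simp add: slope_less_iff_intercept)
qed

lemma cup_below_point_above_chord:
  assumes "is_cup k ps" "q \<in> set ps" "fst (hd ps) < fst x" "fst x < fst (last ps)"
    and "slope (hd ps) (last ps) < slope (hd ps) x"
  shows "intercept (slope (hd ps) (last ps)) q < intercept (slope (hd ps) (last ps)) x"
    (is "intercept ?t q < _")
proof -
  have "intercept ?t q \<le> intercept ?t (hd ps)"
    using cup_below_chord assms by simp
  also have "\<dots> < intercept ?t x" using assms by (simp flip: less_slope_iff_intercept)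
  finally show ?thesis .
qed

lemma cup_insert_above_chord_convex_position:
  assumes cup: "is_cup k ps" "ps \<noteq> []"
    and x: "fst (hd ps) < fst x" "fst x < fst (last ps)"
      "slope (hd ps) (last ps) < slope (hd ps) x"
  shows "convex_position (insert x (set ps))"
proof (rule convex_position_if_exposed)
  let ?t = "slope (hd ps) (last ps)"
  fix p assume "p \<in> insert x (set ps)"
  then consider (apex) "p = x" | (on_cup) "p \<in> set ps" by blast
  then show "\<exists>a. \<forall>q \<in> insert x (set ps) - {p}. inner a p < inner a q"
  proof cases
    case apex
    have "inner (?t, - 1) z = - intercept ?t z" for z :: point
      by (simp add: intercept_def inner_prod_def)
    then have "\<forall>q \<in> insert x (set ps) - {p}. inner (?t, - 1) p < inner (?t, - 1) q"
      using cup_below_point_above_chord[OF cup(1) _ x] apex by simp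
    then show ?thesis by blast
  next
    case on_cup
    then obtain t where t: "\<And>q. q \<in> set ps - {p} \<Longrightarrow> intercept t p < intercept t q"
      using cup_supporting_line[OF cup(1)] by blast
    then have "intercept t p \<le> min (intercept t (hd ps)) (intercept t (last ps))"
      using cup(2) by (metis Diff_iff empty_iff hd_in_set insert_iff last_in_set
          min.bounded_iff order.order_iff_strict)
    also have "\<dots> < intercept t x" using x by (rule min_intercept_less_if_above_chord)
    finally have "\<forall>q \<in> insert x (set ps) - {p}. intercept t p < intercept t q"
      using t by blast
    then show ?thesis unfolding intercept_eq_inner by blast
  qed
qed

lemma cup_insert_above_chord_has_convex_gon:
  assumes cup: "is_cup k ps" "ps \<noteq> []" and P: "set ps \<subseteq> P" "x \<in> P"
    and x: "fst (hd ps) < fst x" "fst x < fst (last ps)"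
      "slope (hd ps) (last ps) < slope (hd ps) x"
  shows "has_convex_gon (Suc k) P"
proof -
  have "x \<notin> set ps"
    using cup_below_point_above_chord[OF cup(1) _ x, of x] by blast
  then have "card (insert x (set ps)) = Suc k"
    using card_set_cup[OF cup(1)] by simp
  then show ?thesis
    unfolding has_convex_gon_def
    using cup_insert_above_chord_convex_position[OF cup x] P
    by (intro exI[of _ "insert x (set ps)"]) auto
qed

section \<open>The cup-cap theorem\<close>

definition cup_ends :: "nat \<Rightarrow> point set \<Rightarrow> point set" where
  "cup_ends k S = last ` {ps. set ps \<subseteq> S \<and> is_cup k ps}"

lemma last_cup_mem: "is_cup k ps \<Longrightarrow> 0 < k \<Longrightarrow> set ps \<subseteq> S \<Longrightarrow> last ps \<in> S"
  by (cases ps rule: rev_cases) (auto simp: is_cup_def)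

lemma cup_ends_subset: "0 < k \<Longrightarrow> cup_ends k S \<subseteq> S"
  by (auto simp: cup_ends_def intro: last_cup_mem)

lemma cup_cap_freeD:
  assumes "cup_cap_free m l S" "set ps \<subseteq> S"
  shows "\<not> is_cup m ps" "\<not> is_cap l ps"
  using assms unfolding cup_cap_free_def by blast+

lemma cup_cap_free_subset:
  "cup_cap_free m l S \<Longrightarrow> T \<subseteq> S \<Longrightarrow> cup_cap_free m l T"
  unfolding cup_cap_free_def by (meson subset_trans)

lemma cup_cap_free_Diff_cup_ends:
  assumes "cup_cap_free m l S" "0 < k"
  shows "cup_cap_free k l (S - cup_ends k S)"
proof -
  have "\<not> is_cup k ps" if "set ps \<subseteq> S - cup_ends k S" for ps
    using that last_cup_mem[OF _ assms(2) that] by (auto simp: cup_ends_def)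
  then show ?thesis
    using assms(1) unfolding cup_cap_free_def by blast
qed

lemma cup_cap_free_cup_ends:
  assumes adm: "admissible S" and free: "cup_cap_free (Suc k) (Suc l) S"
    and k: "2 \<le> k" and l: "2 \<le> l"
  shows "cup_cap_free (Suc k) l (cup_ends k S)"
proof -
  have sub: "cup_ends k S \<subseteq> S" using k by (intro cup_ends_subset) simp
  have "\<not> is_cap l qs" if qs: "set qs \<subseteq> cup_ends k S" for qs
  proof
    assume cap: "is_cap l qs"
    then obtain v w ws where qs_eq: "qs = v # w # ws"
      using l by (cases qs; cases "tl qs") (auto simp: is_cap_def)
    then obtain ps where ps: "set ps \<subseteq> S" "is_cup k ps" "last ps = v"
      using qs by (auto simp: cup_ends_def)
    have S: "w \<in> S" "set qs \<subseteq> S" using qs sub by (auto simp: qs_eq)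
    have "is_cup (Suc k) (ps @ [w]) \<or> (\<exists>u \<in> S. is_cap (Suc l) (u # qs))"
      using cup_or_cap_extends[OF adm ps(2) k ps(1), of l w ws] cap S(1)
      by (simp add: ps(3) qs_eq)
    moreover have "\<not> is_cup (Suc k) (ps @ [w])"
      using ps(1) S(1) by (intro cup_cap_freeD(1)[OF free]) simp
    moreover have "\<not> is_cap (Suc l) (u # qs)" if "u \<in> S" for u
      using that S(2) by (intro cup_cap_freeD(2)[OF free]) simp
    ultimately show False by blast
  qed
  then show ?thesis
    using cup_cap_free_subset[OF free sub] unfolding cup_cap_free_def by blast
qed

lemma card_le_1_if_cup_cap_free_2:
  assumes adm: "admissible S" and free: "cup_cap_free m l S" and "m = 2 \<or> l = 2"
  shows "card S \<le> 1"
proof -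
  have "\<not> fst p < fst q" if "p \<in> S" "q \<in> S" for p q
  proof
    assume "fst p < fst q"
    then have "is_cup 2 [p, q]" "is_cap 2 [p, q]" by (simp_all add: is_cup_def is_cap_def)
    moreover have "set [p, q] \<subseteq> S" using that by simp
    ultimately show False
      using cup_cap_freeD[OF free] \<open>m = 2 \<or> l = 2\<close> by blast
  qed
  then have "p = q" if "p \<in> S" "q \<in> S" for p q
    using that adm by (metis admissible_fst_eq_iff linorder_neqE)
  then show ?thesis
    using adm by (simp add: admissible_def card_le_Suc0_iff_eq)
qed

theorem cup_cap_free_card_le:
  assumes "admissible S" "cup_cap_free m l S" "2 \<le> m" "2 \<le> l"
  shows "card S \<le> (m + l - 4) choose (m - 2)"
  using assms
proof (induction "m + l" arbitrary: m l S rule: less_induct)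
  case less
  note adm = less.prems(1) and free = less.prems(2)
  show ?case
  proof (cases "m = 2 \<or> l = 2")
    case True
    then show ?thesis using card_le_1_if_cup_cap_free_2[OF adm free] by auto
  next
    case False
    then have "m = Suc (Suc (Suc (m - 3)))" "l = Suc (Suc (Suc (l - 3)))"
      using less.prems(3,4) by auto
    then obtain a b where m: "m = Suc (a + 2)" and l: "l = Suc (b + 2)"
      by (metis add_2_eq_Suc')
    let ?T = "cup_ends (a + 2) S"
    have T: "?T \<subseteq> S" by (intro cup_ends_subset) simp
    have "card (S - ?T) \<le> (a + 2 + l - 4) choose (a + 2 - 2)"
      using m l
      by (intro less.hyps admissible_subset[OF adm] cup_cap_free_Diff_cup_ends[OF free]) auto
    moreover have "card ?T \<le> (m + (b + 2) - 4) choose (m - 2)"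
      using m l T free
      by (intro less.hyps admissible_subset[OF adm]) (auto intro: cup_cap_free_cup_ends[OF adm])
    moreover have "card S = card (S - ?T) + card ?T"
      using T adm by (metis admissible_def card_Diff_subset card_mono finite_subset
          le_add_diff_inverse2)
    ultimately show ?thesis using m l by simp
  qed
qed

section \<open>Convexifying points\<close>

lemma four_cup_or_convex_gon_if_between_ends:
  assumes cup: "is_cup n ps" "ps \<noteq> []" "set ps \<subseteq> P" "hd ps = s" "last ps = b"
    and c: "c \<in> P" "fst s < fst c" "fst c < fst b" "slope s b \<noteq> slope s c"
    and a: "fst a < fst s" "slope a s < slope s c"
  shows "is_cup 4 [a, s, c, b] \<or> has_convex_gon (Suc n) P"
proof (cases "slope s b < slope s c")
  case True
  then show ?thesis
    using cup_insert_above_chord_has_convex_gon[OF cup(1-3) c(1)] cup(4,5) c by blast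
next
  case False
  then have "slope s c < slope c b"
    using c chord_slope_iff_left(1)[of s c b] by simp
  then show ?thesis using a c(2,3) by (simp add: is_cup_def)
qed

lemma cup_before_cap_above_chord:
  assumes adm: "admissible P"
    and cup: "is_cup n ps" "set ps \<subseteq> P" "hd ps = s" "last ps = b" "3 \<le> n"
    and cap: "is_cap k (s # c # cs)" "c \<in> P" "fst b < fst c" "slope s c < slope s b"
    and a: "fst a < fst s" "slope a s < slope s c"
  obtains (four_cup) r where "r \<in> P" "is_cup 4 [a, s, r, b]"
  | (longer_cap) q r where "q \<in> P" "r \<in> P" "is_cap (Suc k) (q # r # c # cs)"
  | (convex_gon) "has_convex_gon (Suc n) P"
proof -
  have "2 \<le> n" using cup(5) by simp
  then obtain us r where ps: "ps = us @ [r, b]" and rb: "fst r < fst b"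
    using is_cup_snocE[OF cup(1)] cup(4) by (metis last.simps last_appendR list.distinct(1))
  have us: "us \<noteq> []" "hd us = s"
    using cup(1,3,5) unfolding ps is_cup_def by (cases us; auto)+
  then have s: "s \<in> set us" using hd_in_set by blast
  have sr: "fst s < fst r"
    using cup(1) s unfolding ps is_cup_def by (auto simp: sorted_wrt_append)
  have cup_r: "is_cup (n - 1) (us @ [r])" "set (us @ [r]) \<subseteq> P" "2 \<le> n - 1"
    and "r \<in> P" "b \<in> P"
    using is_cup_butlast[of n us r b] cup(1,2,5) unfolding ps by auto
  consider (r_above) "slope a s < slope s r" | (r_below) "slope s r < slope s c"
    using a(2) by linarith
  then show thesis
  proof cases
    case r_above
    moreover have "slope s r < slope r b"
      using cup_slope_less[of n us r "[b]"] cup(1) s unfolding ps by simp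
    ultimately have "is_cup 4 [a, s, r, b]" using a(1) sr rb by (simp add: is_cup_def)
    then show thesis using four_cup \<open>r \<in> P\<close> by blast
  next
    case r_below
    then consider (cup_extends) "is_cup n (us @ [r, c])"
      | (cap_extends) q where "q \<in> P" "is_cap (Suc k) (q # r # c # cs)"
      using cup_or_cap_extends_below_chord[OF adm cup_r(1,3,2), of k c cs] us cap(1-3) rb cup(5)
      by auto
    then show thesis
    proof cases
      case cup_extends
      then have "has_convex_gon (Suc n) P"
        using us cup_r(2) \<open>b \<in> P\<close> cap(2-4) sr rb
        by (intro cup_insert_above_chord_has_convex_gon[OF cup_extends, of P b]) auto
      then show thesis by (rule convex_gon)
    next
      case cap_extends
      then show thesis using longer_cap \<open>r \<in> P\<close> by blast
    qed
  qed
qed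

lemma cup_and_cap_with_common_left_end:
  assumes adm: "admissible P"
    and cup: "is_cup n ps" "set ps \<subseteq> P" "hd ps = s" "3 \<le> n"
    and cap: "is_cap k (s # c # cs)" "c \<in> P" "c \<noteq> last ps"
    and a: "fst a < fst s" "slope a s < slope s c"
  obtains (four_cup) x y where "x \<in> P" "y \<in> P" "is_cup 4 [a, s, x, y]"
  | (longer_cap) x y where "x \<in> P" "y \<in> P" "is_cap (Suc k) (x # y # c # cs)"
  | (convex_gon) "has_convex_gon (Suc n) P"
proof -
  define b where "b = last ps"
  have "ps \<noteq> []" using cup(1,4) by (auto simp: is_cup_def)
  then have mem: "s \<in> P" "b \<in> P" using cup(2,3) hd_in_set last_in_set by (auto simp: b_def)
  have bc: "fst b \<noteq> fst c"
    using admissible_fst_eq_iff[OF adm mem(2) cap(2)] cap(3) by (auto simp: b_def)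
  have "s \<noteq> b" using cup_fst_hd_less_last[OF cup(1)] cup(3,4) by (auto simp: b_def)
  have sc: "fst s < fst c" using cap(1) by (simp add: is_cap_def)
  have "slope b s \<noteq> slope s c"
    using adm cap(2) mem sc bc \<open>s \<noteq> b\<close> by (intro admissible_slope_neq[of P]) auto
  then have neq: "slope s b \<noteq> slope s c" by (simp add: slope_commute)
  then consider (c_left) "fst c < fst b"
    | (c_right_above) "fst b < fst c" "slope s b < slope s c"
    | (c_right_below) "fst b < fst c" "slope s c < slope s b"
    using bc by linarith
  then show thesis
  proof cases
    case c_left
    then have "is_cup 4 [a, s, c, b] \<or> has_convex_gon (Suc n) P"
      using \<open>ps \<noteq> []\<close> b_def cap(2) sc neq a
      by (intro four_cup_or_convex_gon_if_between_ends[OF cup(1) _ cup(2,3)]) auto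
    then show thesis using four_cup convex_gon cap(2) mem(2) by blast
  next
    case c_right_above
    then consider "is_cup (Suc n) (ps @ [c])"
      | p where "p \<in> P" "is_cap (Suc k) (p # b # c # cs)"
      using cup_or_cap_extends_below_chord[OF adm cup(1) _ cup(2), of k c cs] cup(3,4) cap(1,2)
      by (auto simp: b_def)
    then show thesis
      using cup_has_convex_gon[of "Suc n" "ps @ [c]" P] convex_gon longer_cap cup(2) cap(2) mem(2)
      by cases auto
  next
    case c_right_below
    then show thesis
      using cup_before_cap_above_chord[OF adm cup(1-3) b_def[symmetric] cup(4) cap(1,2) _ _ a]
        four_cup longer_cap convex_gon mem(2) by blast
  qed
qed

lemma slope_less_before_maximal_cap:
  assumes adm: "admissible S" and free: "cup_cap_free m l S"
    and a: "a \<in> S" "fst a < fst s"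
    and cap: "is_cap (l - 1) (s # c # cs)" "set (s # c # cs) \<subseteq> S"
  shows "slope a s < slope s c"
proof -
  have "fst s < fst c" using cap(1) by (simp add: is_cap_def)
  then have "slope a s \<noteq> slope s c"
    using adm a cap(2) by (intro admissible_slope_neq[of S]) auto
  moreover have "\<not> is_cap l (a # s # c # cs)"
    using a(1) cap(2) by (intro cup_cap_freeD(2)[OF free]) simp
  ultimately show ?thesis
    using cap(1) a(2) by (auto simp: is_cap_Cons_iff)
qed

lemma cap_left_end_convexifying:
  assumes l: "4 \<le> l" and adm: "admissible S" and free: "cup_cap_free 4 l S"
    and a: "a \<in> S" "fst a < fst (hd cs)"
    and cap: "is_cap (l - 1) cs" "set cs \<subseteq> S"
  shows "convexifying_point 4 l S (hd cs)"
  unfolding convexifying_point_def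
proof (intro conjI allI impI)
  obtain s c ds where cs: "cs = s # c # ds"
    using cap(1) l by (cases cs; cases "tl cs") (auto simp: is_cap_def)
  have asc: "slope a s < slope s c"
    using slope_less_before_maximal_cap[OF adm free a(1)] a(2) cap by (simp add: cs)
  show "hd cs \<in> S" using cap(2) by (simp add: cs)
  show "\<exists>ps. set ps \<subseteq> S \<and> is_cap (l - 1) ps \<and> hd ps = hd cs" using cap by blast
  fix n :: nat and B
  let ?P = "B \<union> S"
  assume n: "4 \<le> n" and "B \<inter> S = {} \<and> admissible ?P \<and>
    (\<exists>ps. set ps \<subseteq> ?P \<and> is_cup (n - 1) ps \<and> hd ps = hd cs \<and> last ps \<in> B)"
  then obtain ps where B: "B \<inter> S = {}" "admissible ?P"
    and ps: "is_cup (n - 1) ps" "set ps \<subseteq> ?P" "hd ps = s" "last ps \<in> B"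
    by (auto simp: cs)
  have c: "c \<in> ?P" "c \<noteq> last ps" and as: "fst a < fst s" and "3 \<le> n - 1"
    using B(1) ps(4) cap(2) a n by (auto simp: cs)
  from B(2) ps(1-3) \<open>3 \<le> n - 1\<close> cap(1)[unfolded cs] c as asc
  show "(\<exists>ps. set ps \<subseteq> ?P \<and> is_cup 4 ps \<and> set (take 2 ps) \<subseteq> S) \<or>
    (\<exists>ps. set ps \<subseteq> ?P \<and> is_cap l ps \<and> set (drop (l - 2) ps) \<subseteq> S) \<or> has_convex_gon n ?P"
  proof (cases rule: cup_and_cap_with_common_left_end)
    case (four_cup x y)
    then show ?thesis using a(1) cap(2)
      by (intro disjI1 exI[of _ "[a, s, x, y]"]) (auto simp: cs)
  next
    case (longer_cap x y)
    have "l - 2 = Suc (Suc (l - 4))" using l by simp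
    then have "set (drop (l - 2) (x # y # c # ds)) \<subseteq> set (c # ds)"
      using set_drop_subset[of "l - 4" "c # ds"] by simp
    then show ?thesis using longer_cap l cap(2)
      by (intro disjI2 disjI1 exI[of _ "x # y # c # ds"]) (auto simp: cs)
  next
    case convex_gon
    then show ?thesis using n by simp
  qed
qed

lemma convexification_le:
  assumes "0 < m" "0 < l"
    and bound: "\<And>S. admissible S \<Longrightarrow> cup_cap_free m l S \<Longrightarrow> \<nexists>s. convexifying_point m l S s \<Longrightarrow>
      card S \<le> N"
  shows "convexification m l \<le> N"
proof -
  let ?Q = "\<lambda>k. \<exists>S. admissible S \<and> card S = k \<and>
    cup_cap_free m l S \<and> (\<nexists>s. convexifying_point m l S s)"
  have bounded: "k \<le> N" if "?Q k" for k using that bound by blast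
  \<comment> \<open>The empty set keeps \<open>GREATEST\<close> from ranging over an empty predicate.\<close>
  have "?Q 0"
    using assms(1,2) by (intro exI[of _ "{}"])
      (auto simp: admissible_def cup_cap_free_def is_cup_def is_cap_def convexifying_point_def)
  then have "?Q (GREATEST k. ?Q k)" using bounded by (rule GreatestI_nat)
  then show ?thesis unfolding convexification_def by (rule bounded)
qed

lemma cup_cap_free_remove_leftmost:
  assumes l: "4 \<le> l" and adm: "admissible S" and free: "cup_cap_free 4 l S"
    and none: "\<nexists>s. convexifying_point 4 l S s"
    and a: "a \<in> S" "\<And>z. z \<in> S \<Longrightarrow> fst a \<le> fst z"
  shows "cup_cap_free 4 (l - 1) (S - {a})"
proof -
  have "\<not> is_cap (l - 1) cs" if cs: "set cs \<subseteq> S - {a}" for cs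
  proof
    assume cap: "is_cap (l - 1) cs"
    then have "cs \<noteq> []" using l by (auto simp: is_cap_def)
    then have "hd cs \<in> S" "hd cs \<noteq> a" using cs hd_in_set[of cs] by blast+
    then have "fst a < fst (hd cs)"
      using a adm by (metis admissible_fst_eq_iff order_le_less)
    then have "convexifying_point 4 l S (hd cs)"
      using cap_left_end_convexifying[OF l adm free a(1) _ cap] cs by blast
    then show False using none by blast
  qed
  then show ?thesis
    using free unfolding cup_cap_free_def by blast
qed

theorem theorem14:
  fixes l :: nat
  assumes "l \<ge> 4"
  shows "convexification 4 l \<le> ((l - 1) choose 2) + 1"
proof (rule convexification_le)
  fix S assume S: "admissible S" "cup_cap_free 4 l S" "\<nexists>s. convexifying_point 4 l S s"
  show "card S \<le> ((l - 1) choose 2) + 1"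
  proof (cases "S = {}")
    case False
    have "finite S" using S(1) by (simp add: admissible_def)
    then obtain a where a: "a \<in> S" "\<And>z. z \<in> S \<Longrightarrow> fst a \<le> fst z"
      using False by (metis arg_min_if_finite(1) arg_min_least)
    have "cup_cap_free 4 (l - 1) (S - {a})"
      using cup_cap_free_remove_leftmost[OF assms S a] .
    then have "card (S - {a}) \<le> (4 + (l - 1) - 4) choose (4 - 2)"
      using assms admissible_subset[OF S(1)] by (intro cup_cap_free_card_le) auto
    then show ?thesis
      using assms a(1) \<open>finite S\<close> by (simp add: card_Diff_singleton)
  qed simp
qed (use assms in auto)

end
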